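(* Let $1\le a\le b$ be fixed integers. Then, as $n\to\infty$, \[ \mathrm{ex}(n,K_3,K_{1,a,b}) = o\!\left(n^{3-\frac 1a}\right). \]
   Context: For graphs $T$ and $H$ (with no isolated vertices) and a positive integer $n$, the generalized Turán number $\mathrm{ex}(n,T,H)$ is the maximum number of copies of $T$ (subgraphs isomorphic to $T$, not necessarily induced) in an $n$-vertex graph that contains no subgraph isomorphic to $H$. $K_3$ is the triangle and $K_{1,a,b}$ is the complete tripartite graph with parts of sizes $1$, $a$, $b$. *)

theory Defs
  imports Complex_Main "HOL-Library.Landau_Symbols"
begin

type_synonym 'a ugraph = "'a set \<times> 'a set set"

abbreviation verts :: "'a ugraph \<Rightarrow> 'a set" where
  "verts G \<equiv> fst G"

abbreviation edges :: "'a ugraph \<Rightarrow> 'a set set" where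
  "edges G \<equiv> snd G"

definition simple_graph :: "'a ugraph \<Rightarrow> bool" where
  "simple_graph G \<longleftrightarrow> finite (verts G) \<and> (\<forall>e\<in>edges G. e \<subseteq> verts G \<and> card e = 2)"

definition subgraph :: "'a ugraph \<Rightarrow> 'a ugraph \<Rightarrow> bool" where
  "subgraph S G \<longleftrightarrow> simple_graph S \<and> verts S \<subseteq> verts G \<and> edges S \<subseteq> edges G"

definition graph_iso :: "'a ugraph \<Rightarrow> 'b ugraph \<Rightarrow> bool" where
  "graph_iso G H \<longleftrightarrow>
     (\<exists>f. bij_betw f (verts G) (verts H) \<and> edges H = (\<lambda>e. f ` e) ` edges G)"

definition copies :: "'b ugraph \<Rightarrow> 'a ugraph \<Rightarrow> 'a ugraph set" where
  "copies T G = {S. subgraph S G \<and> graph_iso T S}"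

definition free_of :: "'b ugraph \<Rightarrow> 'a ugraph \<Rightarrow> bool" where
  "free_of H G \<longleftrightarrow> copies H G = {}"

definition turan_counts :: "nat \<Rightarrow> 'a ugraph \<Rightarrow> 'b ugraph \<Rightarrow> nat set" where
  "turan_counts n T H =
     {card (copies T G) | G :: nat ugraph.
        simple_graph G \<and> card (verts G) = n \<and> free_of H G}"

text \<open>
  Every finite graph is isomorphic to one whose vertices are natural numbers, so letting the host
  graph range over such graphs loses nothing. The maximum is that of a finite set, which is
  nonempty as soon as \<open>H\<close> has an edge; both facts are proved below.
\<close>

definition generalized_turan :: "nat \<Rightarrow> 'a ugraph \<Rightarrow> 'b ugraph \<Rightarrow> nat" where
  "generalized_turan n T H = Max (turan_counts n T H)"

definition complete_graph :: "nat \<Rightarrow> nat ugraph" where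
  "complete_graph k = ({..<k}, {e. e \<subseteq> {..<k} \<and> card e = 2})"

text \<open>The first component of a vertex says which of the three parts it belongs to.\<close>

definition tripartite_verts :: "nat \<Rightarrow> nat \<Rightarrow> nat \<Rightarrow> (nat \<times> nat) set" where
  "tripartite_verts r s t = {0} \<times> {..<r} \<union> {1} \<times> {..<s} \<union> {2} \<times> {..<t}"

definition complete_tripartite :: "nat \<Rightarrow> nat \<Rightarrow> nat \<Rightarrow> (nat \<times> nat) ugraph" where
  "complete_tripartite r s t =
     (tripartite_verts r s t,
      {{u, v} | u v. u \<in> tripartite_verts r s t \<and> v \<in> tripartite_verts r s t \<and> fst u \<noteq> fst v})"

lemma simple_graph_complete_graph: "simple_graph (complete_graph k)"
  by (auto simp: simple_graph_def complete_graph_def)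

lemma simple_graph_complete_tripartite: "simple_graph (complete_tripartite r s t)"
proof -
  have "finite (tripartite_verts r s t)" by (simp add: tripartite_verts_def)
  moreover have "card {u, v} = 2" if "fst u \<noteq> fst v" for u v :: "nat \<times> nat"
    using that by (metis card_2_iff)
  ultimately show ?thesis unfolding simple_graph_def complete_tripartite_def by auto
qed

lemma card_copies_le:
  fixes G :: "'a ugraph"
  assumes "simple_graph G" "card (verts G) = n"
  shows "finite (copies T G)" "card (copies T G) \<le> 2 ^ n * 2 ^ (2 ^ n)"
proof -
  have fin: "finite (verts G)" using assms(1) by (simp add: simple_graph_def)
  have sub: "copies T G \<subseteq> Pow (verts G) \<times> Pow (Pow (verts G))"
  proof
    fix S assume "S \<in> copies T G"
    then have S: "subgraph S G" by (simp add: copies_def)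
    have "verts S \<in> Pow (verts G)" using S by (simp add: subgraph_def)
    moreover have "edges S \<in> Pow (Pow (verts G))"
      using S unfolding subgraph_def simple_graph_def by blast
    ultimately show "S \<in> Pow (verts G) \<times> Pow (Pow (verts G))"
      by (simp add: mem_Times_iff)
  qed
  have fin': "finite (Pow (verts G) \<times> Pow (Pow (verts G)))" using fin by simp
  show "finite (copies T G)" using finite_subset[OF sub fin'] .
  have "card (copies T G) \<le> card (Pow (verts G) \<times> Pow (Pow (verts G)))"
    using card_mono[OF fin' sub] .
  also have "\<dots> = 2 ^ n * 2 ^ (2 ^ n)"
    using fin assms(2) by (simp add: card_cartesian_product card_Pow)
  finally show "card (copies T G) \<le> 2 ^ n * 2 ^ (2 ^ n)" .
qed

lemma finite_turan_counts: "finite (turan_counts n T H)"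
proof (rule finite_subset)
  show "turan_counts n T H \<subseteq> {..2 ^ n * 2 ^ (2 ^ n)}"
    unfolding turan_counts_def using card_copies_le(2)[OF _ refl, of _ T] by fastforce
qed simp

lemma turan_counts_nonempty:
  assumes "edges H \<noteq> {}"
  shows "turan_counts n T H \<noteq> {}"
proof -
  let ?G = "({..<n}, {}) :: nat ugraph"
  have "simple_graph ?G" by (simp add: simple_graph_def)
  moreover have "free_of H ?G"
    using assms by (auto simp: free_of_def copies_def subgraph_def graph_iso_def)
  ultimately have "card (copies T ?G) \<in> turan_counts n T H"
    unfolding turan_counts_def by fastforce
  then show ?thesis by blast
qed

end

theory Submission
  imports Defs "HOL-Analysis.Convex" "HOL-Real_Asymp.Real_Asymp"
begin

text \<open>In a \<open>K\<^bsub>1,a,b\<^esub>\<close>-free graph any \<open>a\<close> neighbours of a vertex \<open>v\<close> have fewer than \<open>b\<close> common neighbours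
  adjacent to \<open>v\<close>. Let \<open>P\<close> be a set of edges and let \<open>X v\<close> consist of the neighbours of \<open>v\<close> along \<open>P\<close>.
  Applying the Kovari--Sos--Turan argument to \<open>X v\<close> and the neighbourhood of \<open>v\<close>, for every \<open>v\<close>,
  shows that for each \<open>\<epsilon> > 0\<close> the triangles with an edge in \<open>P\<close> number at most
  \<open>\<epsilon> n^(3 - 1/a) + O(n^(1 - 1/a) |P|)\<close>, the constant depending on \<open>\<epsilon>\<close>. With all edges as \<open>P\<close> this gives only
  \<open>O(n^(3 - 1/a)) = o(n^3)\<close> triangles. By the triangle removal lemma, \<open>o(n^2)\<close> edges therefore meet all
  triangles, and the same bound with these edges as \<open>P\<close> proves the theorem.\<close>

section \<open>Conditional means and energy\<close>

text \<open>The conditional expectation of \<open>f\<close> given \<open>c\<close> under the uniform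
  measure on \<open>W\<close>. An empty fibre gets the value 0, by the convention for division by
  zero.\<close>

definition cond_mean :: "'a set \<Rightarrow> ('a \<Rightarrow> 'b) \<Rightarrow> ('a \<Rightarrow> real) \<Rightarrow> 'a \<Rightarrow> real" where
  "cond_mean W c f z =
     (\<Sum>z'\<in>{z'\<in>W. c z' = c z}. f z') / real (card {z'\<in>W. c z' = c z})"

lemma cond_mean_cong: "c z = c z' \<Longrightarrow> cond_mean W c f z = cond_mean W c f z'"
  by (simp add: cond_mean_def)

lemma cond_mean_bounds:
  assumes "finite W" "\<And>z. z \<in> W \<Longrightarrow> 0 \<le> f z \<and> f z \<le> 1"
  shows "0 \<le> cond_mean W c f z" "cond_mean W c f z \<le> 1"
proof -
  show "0 \<le> cond_mean W c f z"
    unfolding cond_mean_def using assms(2) by (intro divide_nonneg_nonneg sum_nonneg) auto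
  have "(\<Sum>z'\<in>{z'\<in>W. c z' = c z}. f z') \<le> (\<Sum>z'\<in>{z'\<in>W. c z' = c z}. 1)"
    using assms(2) by (intro sum_mono) auto
  then show "cond_mean W c f z \<le> 1"
    unfolding cond_mean_def by (intro divide_le_eq_1[THEN iffD2]) auto
qed

text \<open>Averaging over the fibres of \<open>c\<close> is the orthogonal projection onto
  functions of \<open>c\<close>, so pairing with such a function \<open>g\<close> does not see it.
  Written out, the left side is a double sum over pairs in a common fibre, and exchanging the two
  variables moves the average from \<open>f\<close> to \<open>g\<close>.\<close>

lemma sum_cond_mean:
  assumes "finite W" and g: "\<And>z z'. z \<in> W \<Longrightarrow> z' \<in> W \<Longrightarrow> c z = c z' \<Longrightarrow> g z = g z'"
  shows "(\<Sum>z\<in>W. g z * cond_mean W c f z) = (\<Sum>z\<in>W. g z * f z)"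
proof -
  define N where "N z = real (card {z'\<in>W. c z' = c z})" for z
  have "(\<Sum>z\<in>W. g z * cond_mean W c f z) = (\<Sum>z\<in>W. \<Sum>z'\<in>{z'\<in>W. c z' = c z}. g z * f z' / N z)"
    unfolding cond_mean_def N_def by (simp add: sum_distrib_left sum_divide_distrib)
  also have "\<dots> = (\<Sum>z'\<in>W. \<Sum>z\<in>{z\<in>W. c z' = c z}. g z * f z' / N z)"
    by (rule sum.swap_restrict) (use assms in auto)
  also have "\<dots> = (\<Sum>z'\<in>W. g z' * f z')"
  proof (rule sum.cong[OF refl])
    fix z' assume z': "z' \<in> W"
    have "(\<Sum>z\<in>{z\<in>W. c z' = c z}. g z * f z' / N z) =
        (\<Sum>z\<in>{z\<in>W. c z' = c z}. g z' * f z' / N z')"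
    proof (rule sum.cong[OF refl])
      fix z assume "z \<in> {z\<in>W. c z' = c z}"
      then have "g z = g z'" "N z = N z'" using g[of z z'] z' by (auto simp: N_def)
      then show "g z * f z' / N z = g z' * f z' / N z'" by simp
    qed
    also have "\<dots> = real (card {z\<in>W. c z = c z'}) * (g z' * f z' / N z')"
      by (simp add: eq_commute[of "c z'"])
    also have "\<dots> = g z' * f z'"
      using z' assms(1) by (auto simp: N_def)
    finally show "(\<Sum>z\<in>{z\<in>W. c z' = c z}. g z * f z' / N z) = g z' * f z'" .
  qed
  finally show ?thesis .
qed

text \<open>The squared L2 norm of the conditional mean, without dividing by
  \<open>card W\<close>.\<close>

definition energy :: "'a set \<Rightarrow> ('a \<Rightarrow> 'b) \<Rightarrow> ('a \<Rightarrow> real) \<Rightarrow> real" where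
  "energy W c f = (\<Sum>z\<in>W. (cond_mean W c f z)\<^sup>2)"

lemma energy_le_card:
  assumes "finite W" "\<And>z. z \<in> W \<Longrightarrow> 0 \<le> f z \<and> f z \<le> 1"
  shows "energy W c f \<le> card W"
proof -
  have "energy W c f \<le> (\<Sum>z\<in>W. 1)"
    unfolding energy_def
    using cond_mean_bounds[where f = f, OF assms] by (intro sum_mono power_le_one) auto
  then show ?thesis by simp
qed

text \<open>Pythagoras: the coarse mean is constant on the fine fibres, hence orthogonal to the
  difference of the two means.\<close>

lemma energy_refine:
  assumes "finite W"
    and refines: "\<And>z z'. z \<in> W \<Longrightarrow> z' \<in> W \<Longrightarrow> c' z = c' z' \<Longrightarrow> c z = c z'"
  shows "energy W c' f = energy W c f + (\<Sum>z\<in>W. (cond_mean W c' f z - cond_mean W c f z)\<^sup>2)"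
proof -
  let ?m = "cond_mean W c f" and ?m' = "cond_mean W c' f"
  have "(\<Sum>z\<in>W. ?m z * ?m' z) = (\<Sum>z\<in>W. ?m z * f z)"
    by (rule sum_cond_mean[OF assms(1)]) (metis cond_mean_cong refines)
  also have "\<dots> = (\<Sum>z\<in>W. ?m z * ?m z)"
    by (rule sum_cond_mean[OF assms(1), symmetric]) (metis cond_mean_cong)
  finally have "(\<Sum>z\<in>W. ?m z * ?m' z) = energy W c f"
    by (simp add: energy_def power2_eq_square)
  moreover have "(\<Sum>z\<in>W. (?m' z - ?m z)\<^sup>2) = energy W c' f + energy W c f - 2 * (\<Sum>z\<in>W. ?m z * ?m' z)"
    unfolding energy_def by (simp add: power2_diff sum.distrib sum_subtractf sum_distrib_left algebra_simps)
  ultimately show ?thesis by simp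
qed

text \<open>\<open>I\<close> is a union of coarse fibres, and each of them contains a set
  \<open>D k\<close> that is a union of fine fibres. On \<open>D k\<close> the fine mean has the
  same sum as \<open>f\<close>, so the deviation of \<open>f\<close> from the coarse mean becomes a
  deviation between the two means. Cauchy-Schwarz turns it into a gain of \<epsilon>^2 per point of
  the fibre.\<close>

lemma energy_increment:
  fixes \<epsilon> :: real
  assumes fin: "finite W" and "0 \<le> \<epsilon>"
    and refines: "\<And>z z'. z \<in> W \<Longrightarrow> z' \<in> W \<Longrightarrow> c' z = c' z' \<Longrightarrow> c z = c z'"
    and I: "I \<subseteq> W" "\<And>z z'. z \<in> I \<Longrightarrow> z' \<in> W \<Longrightarrow> c z' = c z \<Longrightarrow> z' \<in> I"
    and D: "\<And>z. z \<in> I \<Longrightarrow> D (c z) \<subseteq> {z'\<in>W. c z' = c z}"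
    and D_const: "\<And>z x y. z \<in> I \<Longrightarrow> x \<in> W \<Longrightarrow> y \<in> W \<Longrightarrow> c' x = c' y \<Longrightarrow> x \<in> D (c z) \<Longrightarrow> y \<in> D (c z)"
    and dev: "\<And>z. z \<in> I \<Longrightarrow>
      \<bar>\<Sum>w\<in>D (c z). f w - cond_mean W c f w\<bar> \<ge> \<epsilon> * card {z'\<in>W. c z' = c z}"
  shows "energy W c' f \<ge> energy W c f + \<epsilon>\<^sup>2 * card I"
proof -
  let ?m = "cond_mean W c f" and ?m' = "cond_mean W c' f"
  let ?C = "\<lambda>k. {z\<in>I. c z = k}"
  have finI: "finite I" using finite_subset[OF I(1) fin] .
  have class_bound: "\<epsilon>\<^sup>2 * card (?C k) \<le> (\<Sum>z\<in>?C k. (?m' z - ?m z)\<^sup>2)" if k: "k \<in> c ` I" for k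
  proof -
    obtain z where z: "z \<in> I" "k = c z" using k by blast
    have C: "?C k = {z'\<in>W. c z' = c z}" using z I by auto
    have DC: "D k \<subseteq> ?C k" using D[OF z(1)] C z(2) by simp
    have finC: "finite (?C k)" using finI by simp
    have DW: "D k \<subseteq> W" using DC I by auto
    \<comment> \<open>The indicator of \<open>D k\<close> is constant on fine fibres, so
      \<open>f\<close> may be replaced by its fine mean.\<close>
    have "(\<Sum>w\<in>W. of_bool (w \<in> D k) * ?m' w) = (\<Sum>w\<in>W. of_bool (w \<in> D k) * f w)"
    proof (rule sum_cond_mean[OF fin])
      fix x y assume xy: "x \<in> W" "y \<in> W" "c' x = c' y"
      have "x \<in> D k \<longleftrightarrow> y \<in> D k"
        using D_const[OF z(1) xy(1,2,3)] D_const[OF z(1) xy(2,1) xy(3)[symmetric]] z(2) by blast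
      then show "of_bool (x \<in> D k) = (of_bool (y \<in> D k) :: real)" by simp
    qed
    then have "(\<Sum>w\<in>D k. ?m' w) = (\<Sum>w\<in>D k. f w)"
      using fin DW by (simp add: sum_of_bool_mult_eq Int_absorb1 Int_commute)
    then have "\<epsilon> * card (?C k) \<le> \<bar>\<Sum>w\<in>D k. ?m' w - ?m w\<bar>"
      using dev[OF z(1)] C z(2) by (simp add: sum_subtractf)
    then have "(\<epsilon> * card (?C k))\<^sup>2 \<le> (\<Sum>w\<in>D k. ?m' w - ?m w)\<^sup>2"
      using \<open>0 \<le> \<epsilon>\<close> power_mono[where n = 2] by fastforce
    \<comment> \<open>Cauchy-Schwarz on \<open>D k\<close>; both factors are then enlarged to the
      whole fibre so that its size can be cancelled.\<close>
    also have "\<dots> \<le> card (D k) * (\<Sum>w\<in>D k. (?m' w - ?m w)\<^sup>2)"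
      using sum_squared_le_sum_of_squares[of "\<lambda>w. ?m' w - ?m w" "D k"] by (simp add: mult.commute)
    also have "\<dots> \<le> card (?C k) * (\<Sum>w\<in>?C k. (?m' w - ?m w)\<^sup>2)"
      using DC finC by (intro mult_mono sum_mono2) (auto simp: card_mono sum_nonneg)
    finally have "card (?C k) * (\<epsilon>\<^sup>2 * card (?C k)) \<le> card (?C k) * (\<Sum>w\<in>?C k. (?m' w - ?m w)\<^sup>2)"
      by (simp add: power2_eq_square algebra_simps)
    moreover have "card (?C k) > 0" using z finC by (auto simp: card_gt_0_iff)
    ultimately show ?thesis by simp
  qed
  have "real (card I) = (\<Sum>k\<in>c ` I. real (card (?C k)))"
    using sum.group[OF finI finite_imageI[OF finI] subset_refl, where g = c and h = "\<lambda>_. 1::real"] by simp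
  then have "\<epsilon>\<^sup>2 * card I = (\<Sum>k\<in>c ` I. \<epsilon>\<^sup>2 * card (?C k))"
    by (simp only: sum_distrib_left)
  also have "\<dots> \<le> (\<Sum>k\<in>c ` I. \<Sum>z\<in>?C k. (?m' z - ?m z)\<^sup>2)"
    by (rule sum_mono) (rule class_bound)
  also have "\<dots> = (\<Sum>z\<in>I. (?m' z - ?m z)\<^sup>2)"
    by (rule sum.group[OF finI finite_imageI[OF finI] subset_refl])
  also have "\<dots> \<le> (\<Sum>z\<in>W. (?m' z - ?m z)\<^sup>2)"
    using fin I(1) by (intro sum_mono2) auto
  also have "\<dots> = energy W c' f - energy W c f"
  proof -
    have "energy W c' f = energy W c f + (\<Sum>z\<in>W. (?m' z - ?m z)\<^sup>2)"
      by (rule energy_refine[OF fin]) (rule refines)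
    then show ?thesis by simp
  qed
  finally show ?thesis by simp
qed

section \<open>The regularity lemma\<close>

text \<open>A partition of \<open>V\<close> is encoded by a set \<open>F\<close> of subsets of \<open>V\<close>: its parts are the atoms of the
  set algebra generated by \<open>F\<close>, so that there are at most \<open>2 ^ card F\<close> of them and enlarging \<open>F\<close>
  refines the partition. Deviations are measured relative to the whole rectangle, which saves the
  usual lower bound on the sizes of the sub-rectangles.\<close>

definition pair_class :: "'a set set \<Rightarrow> 'a \<times> 'a \<Rightarrow> 'a set set \<times> 'a set set" where
  "pair_class F z = ({S\<in>F. fst z \<in> S}, {S\<in>F. snd z \<in> S})"

definition cell :: "'a set \<Rightarrow> 'a set set \<Rightarrow> 'a \<Rightarrow> 'a set" where
  "cell V F x = {y\<in>V. \<forall>S\<in>F. y \<in> S \<longleftrightarrow> x \<in> S}"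

text \<open>For an edge indicator \<open>f\<close> this is the edge density between the cells of the
  two entries.\<close>

definition pair_mean :: "'a set \<Rightarrow> 'a set set \<Rightarrow> ('a \<times> 'a \<Rightarrow> real) \<Rightarrow> 'a \<times> 'a \<Rightarrow> real" where
  "pair_mean V F f = cond_mean (V \<times> V) (pair_class F) f"

text \<open>A set of pairs of vertices rather than of cells: on \<open>V \<times> V\<close>
  membership depends only on the cells of the entries, so the cardinality counts every irregular
  pair of cells with its area.\<close>

definition irregular_pairs ::
  "'a set \<Rightarrow> 'a set set \<Rightarrow> ('a \<times> 'a \<Rightarrow> real) \<Rightarrow> real \<Rightarrow> ('a \<times> 'a) set" where
  "irregular_pairs V F f \<epsilon> = {z \<in> V \<times> V. \<exists>A B. A \<subseteq> cell V F (fst z) \<and> B \<subseteq> cell V F (snd z) \<and>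
     \<bar>\<Sum>w\<in>A \<times> B. f w - pair_mean V F f w\<bar> > \<epsilon> * card (cell V F (fst z) \<times> cell V F (snd z))}"

lemma finite_cell: "finite V \<Longrightarrow> finite (cell V F x)"
  by (simp add: cell_def)

lemma cell_self: "x \<in> V \<Longrightarrow> x \<in> cell V F x"
  by (simp add: cell_def)

lemma pair_class_fiber:
  "{z'\<in>V \<times> V. pair_class F z' = pair_class F z} = cell V F (fst z) \<times> cell V F (snd z)"
  by (auto simp: pair_class_def cell_def set_eq_iff)

text \<open>Both sides of a witnessing rectangle are added to \<open>F\<close> for every irregular
  pair of cells. There are at most \<open>4 ^ card F\<close> pairs of cells, hence at most twice as
  many new sets, and each witness becomes a union of classes of the refined partition.\<close>

lemma energy_increment_irregular:
  assumes finV: "finite V" and finF: "finite F" and "0 \<le> \<epsilon>"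
  obtains F' where "finite F'" "card F' \<le> card F + 2 * 4 ^ card F"
    "energy (V \<times> V) (pair_class F') f \<ge>
       energy (V \<times> V) (pair_class F) f + \<epsilon>\<^sup>2 * card (irregular_pairs V F f \<epsilon>)"
proof -
  let ?I = "irregular_pairs V F f \<epsilon>" and ?c = "pair_class F"
  define P where "P z A B \<longleftrightarrow> A \<subseteq> cell V F (fst z) \<and> B \<subseteq> cell V F (snd z) \<and>
     \<bar>\<Sum>w\<in>A \<times> B. f w - pair_mean V F f w\<bar> > \<epsilon> * card (cell V F (fst z) \<times> cell V F (snd z))" for z A B
  have "\<forall>z\<in>?I. \<exists>A B. P z A B"
    unfolding P_def irregular_pairs_def by blast
  then obtain A where "\<forall>z\<in>?I. \<exists>B. P z (A z) B"
    using bchoice[of ?I "\<lambda>z A. \<exists>B. P z A B"] by blast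
  then obtain B where "\<forall>z\<in>?I. P z (A z) (B z)"
    using bchoice[of ?I "\<lambda>z B. P z (A z) B"] by blast
  then have A: "\<And>z. z \<in> ?I \<Longrightarrow> A z \<subseteq> cell V F (fst z)"
    and B: "\<And>z. z \<in> ?I \<Longrightarrow> B z \<subseteq> cell V F (snd z)"
    and dev: "\<And>z. z \<in> ?I \<Longrightarrow> \<bar>\<Sum>w\<in>A z \<times> B z. f w - pair_mean V F f w\<bar>
        > \<epsilon> * card (cell V F (fst z) \<times> cell V F (snd z))"
    unfolding P_def by blast+
  \<comment> \<open>The witnesses were chosen for single pairs of vertices; one representative per
    pair of cells keeps the number of added sets independent of \<open>V\<close>.\<close>
  define rep where "rep k = inv_into ?I ?c k" for k
  have rep: "rep (?c z) \<in> ?I" "?c (rep (?c z)) = ?c z" if "z \<in> ?I" for z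
    using that by (auto simp: rep_def inv_into_into f_inv_into_f)
  define D where "D k = A (rep k) \<times> B (rep k)" for k
  define K where "K = ?c ` ?I"
  define F' where "F' = F \<union> (A \<circ> rep) ` K \<union> (B \<circ> rep) ` K"
  have K_sub: "K \<subseteq> Pow F \<times> Pow F" by (auto simp: K_def pair_class_def)
  have finK: "finite K" using finite_subset[OF K_sub] finF by simp
  have "card K \<le> card (Pow F \<times> Pow F)" using card_mono[OF _ K_sub] finF by simp
  also have "\<dots> = 4 ^ card F"
    using finF by (simp add: card_cartesian_product card_Pow flip: power_mult_distrib)
  finally have cardK: "card K \<le> 4 ^ card F" .
  have "card F' \<le> card F + card ((A \<circ> rep) ` K) + card ((B \<circ> rep) ` K)"
    unfolding F'_def by (intro order.trans[OF card_Un_le] add_mono order.refl)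
  also have "\<dots> \<le> card F + 2 * 4 ^ card F"
    using cardK card_image_le[OF finK, of "A \<circ> rep"] card_image_le[OF finK, of "B \<circ> rep"] by linarith
  finally have cardF': "card F' \<le> card F + 2 * 4 ^ card F" .
  have finF': "finite F'" using finF finK by (simp add: F'_def)
  have fiber_rep: "{w\<in>V \<times> V. ?c w = ?c z} = cell V F (fst (rep (?c z))) \<times> cell V F (snd (rep (?c z)))"
    if "z \<in> ?I" for z
    using pair_class_fiber[of V F "rep (?c z)"] rep(2)[OF that] by simp
  have "energy (V \<times> V) (pair_class F') f \<ge> energy (V \<times> V) ?c f + \<epsilon>\<^sup>2 * card ?I"
  proof (rule energy_increment[where D = D and c = ?c and c' = "pair_class F'" and I = ?I and W = "V \<times> V" and f = f])
    show "finite (V \<times> V)" using finV by simp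
    show "?c z = ?c z'" if eq: "pair_class F' z = pair_class F' z'" for z z'
    proof -
      have "{S\<in>F'. fst z \<in> S} \<inter> F = {S\<in>F'. fst z' \<in> S} \<inter> F"
        "{S\<in>F'. snd z \<in> S} \<inter> F = {S\<in>F'. snd z' \<in> S} \<inter> F"
        using eq by (simp_all add: pair_class_def)
      then show ?thesis unfolding pair_class_def F'_def by blast
    qed
    show "?I \<subseteq> V \<times> V" by (auto simp: irregular_pairs_def)
    show "z' \<in> ?I" if "z \<in> ?I" "z' \<in> V \<times> V" "?c z' = ?c z" for z z'
    proof -
      have "cell V F (fst z') \<times> cell V F (snd z') = cell V F (fst z) \<times> cell V F (snd z)"
        using pair_class_fiber[of V F z] pair_class_fiber[of V F z'] that(3) by simp
      \<comment> \<open>Equal rectangles have equal sides only if they are nonempty.\<close>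
      moreover have "z \<in> cell V F (fst z) \<times> cell V F (snd z)"
        using that(1) by (auto simp: irregular_pairs_def cell_self)
      ultimately have "cell V F (fst z') = cell V F (fst z)" "cell V F (snd z') = cell V F (snd z)"
        by (auto simp: times_eq_iff)
      with that(1,2) show ?thesis by (simp add: irregular_pairs_def)
    qed
    show "D (?c z) \<subseteq> {w\<in>V \<times> V. ?c w = ?c z}" if "z \<in> ?I" for z
      unfolding fiber_rep[OF that] D_def using A B rep(1)[OF that] by (intro Sigma_mono) auto
    show "y \<in> D (?c z)"
      if z: "z \<in> ?I" and eq: "pair_class F' x = pair_class F' y" and x: "x \<in> D (?c z)" for x y z
    proof -
      have "A (rep (?c z)) \<in> F'" "B (rep (?c z)) \<in> F'" using z by (auto simp: F'_def K_def)
      then show ?thesis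
        using eq x by (cases x; cases y) (auto simp: D_def pair_class_def set_eq_iff)
    qed
    show "\<epsilon> * card {w\<in>V \<times> V. ?c w = ?c z} \<le> \<bar>\<Sum>w\<in>D (?c z). f w - cond_mean (V \<times> V) ?c f w\<bar>"
      if "z \<in> ?I" for z
      using dev[OF rep(1)[OF that]] unfolding fiber_rep[OF that] D_def pair_mean_def by simp
  qed (fact \<open>0 \<le> \<epsilon>\<close>)
  with that finF' cardF' show ?thesis by blast
qed

text \<open>Each round that fails to reach regularity gains at least \<epsilon>^2 times \<epsilon>
  n^2 in energy, where n is the size of \<open>V\<close>. The bound \<open>M\<close> is quantified
  before \<open>V\<close> and \<open>f\<close>, which makes it uniform.\<close>

lemma regularity_step:
  fixes \<epsilon> :: real
  assumes "0 < \<epsilon>"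
  shows "\<exists>M. \<forall>(V :: 'a set) f. finite V \<longrightarrow>
    (\<exists>F. finite F \<and> card F \<le> M \<and> (card (irregular_pairs V F f \<epsilon>) \<le> \<epsilon> * (card V)\<^sup>2 \<or>
       energy (V \<times> V) (pair_class F) f \<ge> real k * \<epsilon> ^ 3 * (card V)\<^sup>2))"
proof (induction k)
  case 0
  show ?case
    by (intro exI[of _ 0] allI impI exI[of _ "{}"]) (simp add: energy_def sum_nonneg)
next
  case (Suc k)
  then obtain M where M: "\<And>(V :: 'a set) f. finite V \<Longrightarrow>
    (\<exists>F. finite F \<and> card F \<le> M \<and> (card (irregular_pairs V F f \<epsilon>) \<le> \<epsilon> * (card V)\<^sup>2 \<or>
       energy (V \<times> V) (pair_class F) f \<ge> real k * \<epsilon> ^ 3 * (card V)\<^sup>2))"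
    by blast
  show ?case
  proof (intro exI[of _ "M + 2 * 4 ^ M"] allI impI)
    fix V :: "'a set" and f :: "'a \<times> 'a \<Rightarrow> real"
    assume finV: "finite V"
    obtain F where F: "finite F" "card F \<le> M" "card (irregular_pairs V F f \<epsilon>) \<le> \<epsilon> * (card V)\<^sup>2 \<or>
       energy (V \<times> V) (pair_class F) f \<ge> real k * \<epsilon> ^ 3 * (card V)\<^sup>2"
      using M[OF finV, of f] by blast
    show "\<exists>F. finite F \<and> card F \<le> M + 2 * 4 ^ M \<and> (card (irregular_pairs V F f \<epsilon>) \<le> \<epsilon> * (card V)\<^sup>2 \<or>
       energy (V \<times> V) (pair_class F) f \<ge> real (Suc k) * \<epsilon> ^ 3 * (card V)\<^sup>2)"
    proof (cases "card (irregular_pairs V F f \<epsilon>) \<le> \<epsilon> * (card V)\<^sup>2")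
      case True
      with F show ?thesis by (intro exI[of _ F]) auto
    next
      case False
      obtain F' where F': "finite F'" "card F' \<le> card F + 2 * 4 ^ card F"
        "energy (V \<times> V) (pair_class F') f \<ge>
          energy (V \<times> V) (pair_class F) f + \<epsilon>\<^sup>2 * card (irregular_pairs V F f \<epsilon>)"
        using energy_increment_irregular[OF finV F(1)] assms by (metis less_imp_le)
      have "(4::nat) ^ card F \<le> 4 ^ M" using F(2) by (intro power_increasing) auto
      then have "card F' \<le> M + 2 * 4 ^ M" using F'(2) F(2) by linarith
      moreover have "\<epsilon>\<^sup>2 * (\<epsilon> * (card V)\<^sup>2) \<le> \<epsilon>\<^sup>2 * card (irregular_pairs V F f \<epsilon>)"
        using False by (intro mult_left_mono) auto
      then have "real (Suc k) * \<epsilon> ^ 3 * (card V)\<^sup>2 \<le> energy (V \<times> V) (pair_class F') f"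
        using F(3) F'(3) False by (auto simp: algebra_simps power2_eq_square power3_eq_cube)
      ultimately show ?thesis using F'(1) by blast
    qed
  qed
qed

text \<open>The energy of a function with values in [0, 1] is at most n^2, so once
  \<open>k * \<epsilon> ^ 3\<close> exceeds 1 the energy alternative of
  \<open>regularity_step\<close> is impossible.\<close>

lemma regularity:
  fixes \<epsilon> :: real
  assumes "0 < \<epsilon>"
  obtains M where "\<And>(V :: 'a set) f. finite V \<Longrightarrow> (\<And>z. z \<in> V \<times> V \<Longrightarrow> 0 \<le> f z \<and> f z \<le> 1) \<Longrightarrow>
    \<exists>F. finite F \<and> card F \<le> M \<and> card (irregular_pairs V F f \<epsilon>) \<le> \<epsilon> * (card V)\<^sup>2"
proof -
  obtain k :: nat where k: "1 < k * \<epsilon> ^ 3"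
    using reals_Archimedean3[of "\<epsilon> ^ 3"] assms by auto
  obtain M where M: "\<And>(V :: 'a set) f. finite V \<Longrightarrow>
    (\<exists>F. finite F \<and> card F \<le> M \<and> (card (irregular_pairs V F f \<epsilon>) \<le> \<epsilon> * (card V)\<^sup>2 \<or>
       energy (V \<times> V) (pair_class F) f \<ge> real k * \<epsilon> ^ 3 * (card V)\<^sup>2))"
    using regularity_step[OF assms, of k] by blast
  show ?thesis
  proof (rule that[of M])
    fix V :: "'a set" and f :: "'a \<times> 'a \<Rightarrow> real"
    assume finV: "finite V" and f: "\<And>z. z \<in> V \<times> V \<Longrightarrow> 0 \<le> f z \<and> f z \<le> 1"
    obtain F where F: "finite F" "card F \<le> M" "card (irregular_pairs V F f \<epsilon>) \<le> \<epsilon> * (card V)\<^sup>2 \<or>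
       energy (V \<times> V) (pair_class F) f \<ge> real k * \<epsilon> ^ 3 * (card V)\<^sup>2"
      using M[OF finV, of f] by blast
    have "energy (V \<times> V) (pair_class F) f \<le> card (V \<times> V)"
      by (rule energy_le_card) (use finV f in auto)
    then have le: "energy (V \<times> V) (pair_class F) f \<le> (card V)\<^sup>2"
      by (simp add: card_cartesian_product power2_eq_square)
    have "card (irregular_pairs V F f \<epsilon>) \<le> \<epsilon> * (card V)\<^sup>2"
    \<comment> \<open>For empty \<open>V\<close> the strict comparison of energies degenerates to 0
      < 0, but there are no pairs at all.\<close>
    proof (cases "V = {}")
      case True
      then show ?thesis by (simp add: irregular_pairs_def)
    next
      case False
      then have "real ((card V)\<^sup>2) > 0" using finV by (simp add: card_gt_0_iff)
      then have "real ((card V)\<^sup>2) < k * \<epsilon> ^ 3 * (card V)\<^sup>2"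
        using mult_strict_right_mono[OF k] by fastforce
      then show ?thesis using le F(3) by linarith
    qed
    with F show "\<exists>F. finite F \<and> card F \<le> M \<and> card (irregular_pairs V F f \<epsilon>) \<le> \<epsilon> * (card V)\<^sup>2"
      by blast
  qed
qed

section \<open>Triangle removal\<close>

text \<open>The three edge indicators are replaced by their densities one after the other; fixing the vertex
  outside the pair in question turns each replacement error into a deviation on a sub-rectangle.\<close>

lemma triangle_counting:
  fixes E :: "'a \<Rightarrow> 'a \<Rightarrow> bool" and d1 d2 d3 \<epsilon> :: real
  assumes fin: "finite A" "finite B" "finite C"
    and d: "0 \<le> d1" "d1 \<le> 1" "0 \<le> d2" "d2 \<le> 1"
    and AB: "\<And>X Y. X \<subseteq> A \<Longrightarrow> Y \<subseteq> B \<Longrightarrow>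
      \<bar>\<Sum>x\<in>X. \<Sum>y\<in>Y. of_bool (E x y) - d1\<bar> \<le> \<epsilon> * (card A * card B)"
    and BC: "\<And>X Y. X \<subseteq> B \<Longrightarrow> Y \<subseteq> C \<Longrightarrow>
      \<bar>\<Sum>x\<in>X. \<Sum>y\<in>Y. of_bool (E x y) - d2\<bar> \<le> \<epsilon> * (card B * card C)"
    and AC: "\<And>X Y. X \<subseteq> A \<Longrightarrow> Y \<subseteq> C \<Longrightarrow>
      \<bar>\<Sum>x\<in>X. \<Sum>y\<in>Y. of_bool (E x y) - d3\<bar> \<le> \<epsilon> * (card A * card C)"
  shows "(d1 * d2 * d3 - 3 * \<epsilon>) * (card A * card B * card C)
    \<le> (\<Sum>x\<in>A. \<Sum>y\<in>B. \<Sum>z\<in>C. of_bool (E x y \<and> E y z \<and> E x z))"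
proof -
  define e :: "'a \<Rightarrow> 'a \<Rightarrow> real" where "e x y = of_bool (E x y)" for x y
  let ?n = "real (card A * card B * card C)"
  have 1: "\<bar>\<Sum>x\<in>A. \<Sum>y\<in>B. \<Sum>z\<in>C. (e x y - d1) * e y z * e x z\<bar> \<le> \<epsilon> * ?n"
  proof -
    \<comment> \<open>With \<open>z\<close> outermost, the factors \<open>e y z\<close> and
      \<open>e x z\<close> merely restrict \<open>x\<close> and \<open>y\<close> to neighbourhoods
      of \<open>z\<close>, which leaves a sub-rectangle of \<open>A \<times> B\<close>.\<close>
    have "(\<Sum>x\<in>A. \<Sum>y\<in>B. \<Sum>z\<in>C. (e x y - d1) * e y z * e x z)
        = (\<Sum>x\<in>A. \<Sum>z\<in>C. \<Sum>y\<in>B. (e x y - d1) * e y z * e x z)"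
      by (intro sum.cong refl sum.swap)
    also have "\<dots> = (\<Sum>z\<in>C. \<Sum>x\<in>A. \<Sum>y\<in>B. (e x y - d1) * e y z * e x z)"
      by (rule sum.swap)
    also have "\<dots> = (\<Sum>z\<in>C. \<Sum>x\<in>A \<inter> {x. E x z}. \<Sum>y\<in>B \<inter> {y. E y z}. e x y - d1)"
      using fin by (simp add: e_def sum_distrib_right[symmetric])
    finally have eq: "(\<Sum>x\<in>A. \<Sum>y\<in>B. \<Sum>z\<in>C. (e x y - d1) * e y z * e x z) = \<dots>" .
    have "\<bar>\<Sum>z\<in>C. \<Sum>x\<in>A \<inter> {x. E x z}. \<Sum>y\<in>B \<inter> {y. E y z}. e x y - d1\<bar>
        \<le> (\<Sum>z\<in>C. \<epsilon> * (card A * card B))"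
      unfolding e_def by (rule order.trans[OF sum_abs sum_mono]) (rule AB; blast)
    then show ?thesis unfolding eq by (simp add: algebra_simps)
  qed
  have 2: "\<bar>\<Sum>x\<in>A. \<Sum>y\<in>B. \<Sum>z\<in>C. d1 * (e y z - d2) * e x z\<bar> \<le> \<epsilon> * ?n"
  proof -
    have eq: "(\<Sum>x\<in>A. \<Sum>y\<in>B. \<Sum>z\<in>C. d1 * (e y z - d2) * e x z)
        = d1 * (\<Sum>x\<in>A. \<Sum>y\<in>B. \<Sum>z\<in>C \<inter> {z. E x z}. e y z - d2)"
      using fin by (simp add: e_def sum_distrib_left)
    have "\<bar>\<Sum>x\<in>A. \<Sum>y\<in>B. \<Sum>z\<in>C \<inter> {z. E x z}. e y z - d2\<bar> \<le> (\<Sum>x\<in>A. \<epsilon> * (card B * card C))"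
      unfolding e_def by (rule order.trans[OF sum_abs sum_mono]) (rule BC; blast)
    then have "d1 * \<bar>\<Sum>x\<in>A. \<Sum>y\<in>B. \<Sum>z\<in>C \<inter> {z. E x z}. e y z - d2\<bar> \<le> 1 * (\<epsilon> * ?n)"
      using d by (intro mult_mono) (auto simp: algebra_simps)
    then show ?thesis unfolding eq using d by (simp add: abs_mult)
  qed
  have 3: "\<bar>\<Sum>x\<in>A. \<Sum>y\<in>B. \<Sum>z\<in>C. d1 * d2 * (e x z - d3)\<bar> \<le> \<epsilon> * ?n"
  proof -
    have eq: "(\<Sum>x\<in>A. \<Sum>y\<in>B. \<Sum>z\<in>C. d1 * d2 * (e x z - d3))
        = d1 * d2 * (card B * (\<Sum>x\<in>A. \<Sum>z\<in>C. e x z - d3))"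
      by (simp add: sum_distrib_left mult.left_commute)
    have "\<bar>\<Sum>x\<in>A. \<Sum>z\<in>C. e x z - d3\<bar> \<le> \<epsilon> * (card A * card C)"
      unfolding e_def by (rule AC) auto
    then have "card B * \<bar>\<Sum>x\<in>A. \<Sum>z\<in>C. e x z - d3\<bar> \<le> card B * (\<epsilon> * (card A * card C))"
      by (intro mult_left_mono) auto
    moreover have "d1 * d2 \<le> 1" using d by (intro mult_le_one) auto
    ultimately have "d1 * d2 * (card B * \<bar>\<Sum>x\<in>A. \<Sum>z\<in>C. e x z - d3\<bar>) \<le> 1 * (\<epsilon> * ?n)"
      using d by (intro mult_mono[of "d1 * d2"]) (auto simp: mult_ac)
    then show ?thesis unfolding eq using d by (simp add: abs_mult)
  qed
  \<comment> \<open>Telescoping: e1 e2 e3 = (e1 - d1) e2 e3 + d1 (e2 - d2) e3 + d1 d2 (e3 - d3) + d1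
    d2 d3.\<close>
  have "(\<Sum>x\<in>A. \<Sum>y\<in>B. \<Sum>z\<in>C. of_bool (E x y \<and> E y z \<and> E x z)) =
    (\<Sum>x\<in>A. \<Sum>y\<in>B. \<Sum>z\<in>C. (e x y - d1) * e y z * e x z + d1 * (e y z - d2) * e x z
      + d1 * d2 * (e x z - d3) + d1 * d2 * d3)"
    by (intro sum.cong refl) (simp add: e_def of_bool_conj algebra_simps)
  also have "\<dots> = (\<Sum>x\<in>A. \<Sum>y\<in>B. \<Sum>z\<in>C. (e x y - d1) * e y z * e x z)
      + (\<Sum>x\<in>A. \<Sum>y\<in>B. \<Sum>z\<in>C. d1 * (e y z - d2) * e x z)
      + (\<Sum>x\<in>A. \<Sum>y\<in>B. \<Sum>z\<in>C. d1 * d2 * (e x z - d3)) + d1 * d2 * d3 * ?n"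
    by (simp only: sum.distrib) simp
  finally show ?thesis using 1 2 3 by (simp add: algebra_simps)
qed

text \<open>There are at most \<open>2 ^ card F\<close> cells, and each small one contributes fewer
  than \<open>t\<close> vertices.\<close>

lemma card_small_cells:
  fixes t :: real
  assumes finV: "finite V" and finF: "finite F" and "0 \<le> t"
  shows "card {x\<in>V. card (cell V F x) < t} \<le> 2 ^ card F * t"
proof -
  let ?S = "{x\<in>V. card (cell V F x) < t}" and ?l = "\<lambda>x. {S\<in>F. x \<in> S}"
  have finS: "finite ?S" using finV by simp
  have sub: "?l ` ?S \<subseteq> Pow F" by auto
  have "real (card ?S) = (\<Sum>k\<in>?l ` ?S. real (card {x\<in>?S. ?l x = k}))"
    using sum.group[OF finS finite_imageI[OF finS] subset_refl, where g = ?l and h = "\<lambda>_. 1::real"]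
    by simp
  also have "\<dots> \<le> (\<Sum>k\<in>?l ` ?S. t)"
  proof (rule sum_mono)
    fix k assume "k \<in> ?l ` ?S"
    then obtain x where x: "x \<in> ?S" "k = ?l x" by blast
    have "{y\<in>?S. ?l y = k} \<subseteq> cell V F x" using x(2) by (auto simp: cell_def set_eq_iff)
    then have "card {y\<in>?S. ?l y = k} \<le> card (cell V F x)"
      by (rule card_mono[OF finite_cell[OF finV]])
    then show "card {y\<in>?S. ?l y = k} \<le> t" using x(1) by simp
  qed
  also have "\<dots> = card (?l ` ?S) * t" by simp
  also have "\<dots> \<le> 2 ^ card F * t"
  proof -
    have "card (?l ` ?S) \<le> 2 ^ card F"
      using card_mono[OF _ sub] finF by (simp add: card_Pow)
    from of_nat_mono[where 'a = real, OF this] have "real (card (?l ` ?S)) \<le> 2 ^ card F"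
      by simp
    then show ?thesis using \<open>0 \<le> t\<close> by (rule mult_right_mono)
  qed
  finally show ?thesis .
qed

text \<open>Low density is a property of the pair of cells, so by \<open>sum_cond_mean\<close> the
  edges in question number exactly the sum of the densities over all low-density pairs, each term
  being below \<gamma>.\<close>

lemma card_low_density_pairs:
  fixes E :: "'a \<Rightarrow> 'a \<Rightarrow> bool" and \<gamma> :: real
  assumes finV: "finite V" and "0 \<le> \<gamma>"
    and m: "m = pair_mean V F (\<lambda>z. of_bool (E (fst z) (snd z)))"
  shows "card {z\<in>V \<times> V. E (fst z) (snd z) \<and> m z < \<gamma>} \<le> \<gamma> * (card V)\<^sup>2"
proof -
  let ?e = "\<lambda>z. of_bool (E (fst z) (snd z)) :: real"
  have fin: "finite (V \<times> V)" using finV by simp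
  have "real (card {z\<in>V \<times> V. E (fst z) (snd z) \<and> m z < \<gamma>}) = (\<Sum>z\<in>V \<times> V. of_bool (E (fst z) (snd z) \<and> m z < \<gamma>))"
    using fin by (simp add: Int_def)
  also have "\<dots> = (\<Sum>z\<in>V \<times> V. of_bool (m z < \<gamma>) * ?e z)"
    by (intro sum.cong refl) (simp add: of_bool_conj)
  also have "\<dots> = (\<Sum>z\<in>V \<times> V. of_bool (m z < \<gamma>) * m z)"
    unfolding m pair_mean_def
  proof (rule sum_cond_mean[OF fin, symmetric])
    fix z z' :: "'a \<times> 'a" assume "pair_class F z = pair_class F z'"
    from cond_mean_cong[where c = "pair_class F", OF this]
    show "of_bool (cond_mean (V \<times> V) (pair_class F) ?e z < \<gamma>) =
      (of_bool (cond_mean (V \<times> V) (pair_class F) ?e z' < \<gamma>) :: real)" by simp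
  qed
  also have "\<dots> \<le> (\<Sum>z\<in>V \<times> V. \<gamma>)"
    using \<open>0 \<le> \<gamma>\<close> by (intro sum_mono) auto
  also have "\<dots> = \<gamma> * (card V)\<^sup>2"
    by (simp add: card_cartesian_product power2_eq_square)
  finally show ?thesis .
qed

text \<open>\<open>P\<close> collects the edges that touch a small cell or lie in a sparse or
  irregular pair of cells. A triangle avoiding \<open>P\<close> would sit in three large cells that
  are pairwise dense and regular, and counting there yields too many triangles. Triangles are
  ordered triples and \<open>E\<close> may be any relation.\<close>

lemma triangle_removal:
  fixes \<delta> :: real
  assumes "0 < \<delta>"
  obtains \<eta> :: real where "0 < \<eta>" "\<And>(V :: 'a set) E. finite V \<Longrightarrow>
    card {(x, y, z) \<in> V \<times> V \<times> V. E x y \<and> E y z \<and> E x z} < \<eta> * card V ^ 3 \<Longrightarrow>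
    \<exists>P \<subseteq> {(x, y) \<in> V \<times> V. E x y}. card P \<le> \<delta> * (card V)\<^sup>2 \<and>
      (\<forall>x\<in>V. \<forall>y\<in>V. \<forall>z\<in>V. E x y \<and> E y z \<and> E x z \<longrightarrow> (x, y) \<in> P \<or> (y, z) \<in> P \<or> (x, z) \<in> P)"
proof -
  \<comment> \<open>Four kinds of edges enter \<open>P\<close>, each numbering at most \<gamma> n^2.
    With 3 \<epsilon> = \<gamma>^3 / 2, half of the main term \<gamma>^3 survives the counting
    errors; \<gamma> \<le> 1 ensures \<epsilon> \<le> \<gamma>.\<close>
  define \<gamma> where "\<gamma> = min (\<delta> / 4) 1"
  define \<epsilon> where "\<epsilon> = \<gamma> ^ 3 / 6"
  have \<gamma>: "0 < \<gamma>" "\<gamma> \<le> 1" "4 * \<gamma> \<le> \<delta>" using assms by (auto simp: \<gamma>_def)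
  have "\<gamma> ^ 3 \<le> \<gamma> ^ 1" using \<gamma> by (intro power_decreasing) auto
  then have \<epsilon>: "0 < \<epsilon>" "\<epsilon> \<le> \<gamma>" using \<gamma> by (auto simp: \<epsilon>_def)
  obtain M where M: "\<And>(V :: 'a set) f. finite V \<Longrightarrow> (\<And>z. z \<in> V \<times> V \<Longrightarrow> 0 \<le> f z \<and> f z \<le> 1) \<Longrightarrow>
      \<exists>F. finite F \<and> card F \<le> M \<and> card (irregular_pairs V F f \<epsilon>) \<le> \<epsilon> * (card V)\<^sup>2"
    using regularity[OF \<epsilon>(1)] by metis
  \<comment> \<open>There are at most 2^M cells, so those below \<kappa> n together hold at most
    \<gamma> n vertices.\<close>
  define \<kappa> where "\<kappa> = \<gamma> / 2 ^ M"
  have \<kappa>: "0 < \<kappa>" using \<gamma> by (simp add: \<kappa>_def)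
  show ?thesis
  proof (rule that[of "\<gamma> ^ 3 / 2 * \<kappa> ^ 3"])
    show "0 < \<gamma> ^ 3 / 2 * \<kappa> ^ 3" using \<gamma> \<kappa> by simp
    fix V :: "'a set" and E
    assume finV: "finite V" and few:
      "card {(x, y, z) \<in> V \<times> V \<times> V. E x y \<and> E y z \<and> E x z} < \<gamma> ^ 3 / 2 * \<kappa> ^ 3 * card V ^ 3"
    define e :: "'a \<times> 'a \<Rightarrow> real" where "e z = of_bool (E (fst z) (snd z))" for z
    define n where "n = real (card V)"
    obtain F where F: "finite F" "card F \<le> M" "card (irregular_pairs V F e \<epsilon>) \<le> \<epsilon> * n\<^sup>2"
      using M[OF finV, of e] by (auto simp: e_def n_def)
    define m where "m = pair_mean V F e"
    define S where "S = {x\<in>V. card (cell V F x) < \<kappa> * n}"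
    define L where "L = {z\<in>V \<times> V. E (fst z) (snd z) \<and> m z < \<gamma>}"
    define I where "I = irregular_pairs V F e \<epsilon>"
    define P where "P = {z\<in>V \<times> V. E (fst z) (snd z)} \<inter> (S \<times> V \<union> V \<times> S \<union> L \<union> I)"
    have n0: "0 \<le> n" by (simp add: n_def)
    have cardS: "card S \<le> \<gamma> * n"
    proof -
      have "card S \<le> 2 ^ card F * (\<kappa> * n)"
        unfolding S_def using finV F(1) \<kappa> n0 by (intro card_small_cells) auto
      also have "\<dots> \<le> 2 ^ M * (\<kappa> * n)"
        using F(2) \<kappa> n0 by (intro mult_right_mono power_increasing) auto
      finally show ?thesis by (simp add: \<kappa>_def)
    qed
    have finS: "finite S" "finite L" "finite I"
      using finV by (auto simp: S_def L_def I_def irregular_pairs_def)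
    have "card P \<le> card (S \<times> V \<union> V \<times> S \<union> L \<union> I)"
      unfolding P_def using finV finS by (intro card_mono) auto
    also have "\<dots> \<le> card (S \<times> V) + card (V \<times> S) + card L + card I"
      by (intro order.trans[OF card_Un_le] add_mono order.refl)
    finally have "real (card P) \<le> card S * n + n * card S + card L + card I"
      by (simp add: card_cartesian_product n_def flip: of_nat_mult of_nat_add)
    also have "\<dots> \<le> \<gamma> * n * n + n * (\<gamma> * n) + \<gamma> * n\<^sup>2 + \<gamma> * n\<^sup>2"
    proof (intro add_mono mult_right_mono mult_left_mono cardS n0)
      show "card L \<le> \<gamma> * n\<^sup>2"
        using card_low_density_pairs[OF finV less_imp_le[OF \<gamma>(1)], of m F E]
        by (simp add: L_def m_def n_def e_def[abs_def])
      have "\<epsilon> * n\<^sup>2 \<le> \<gamma> * n\<^sup>2" using \<epsilon> by (intro mult_right_mono) auto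
      then show "card I \<le> \<gamma> * n\<^sup>2" using F(3) unfolding I_def by linarith
    qed
    also have "\<dots> = 4 * \<gamma> * n\<^sup>2" by (simp add: power2_eq_square)
    also have "\<dots> \<le> \<delta> * n\<^sup>2" using \<gamma> by (intro mult_right_mono) auto
    finally have cardP: "card P \<le> \<delta> * n\<^sup>2" .
    have good: "E x y \<Longrightarrow> (x, y) \<in> V \<times> V \<Longrightarrow> (x, y) \<notin> P \<Longrightarrow>
        card (cell V F x) \<ge> \<kappa> * n \<and> card (cell V F y) \<ge> \<kappa> * n \<and> \<gamma> \<le> m (x, y) \<and> m (x, y) \<le> 1 \<and>
        (\<forall>X Y. X \<subseteq> cell V F x \<longrightarrow> Y \<subseteq> cell V F y \<longrightarrow>
          \<bar>\<Sum>u\<in>X. \<Sum>v\<in>Y. of_bool (E u v) - m (x, y)\<bar> \<le> \<epsilon> * (card (cell V F x) * card (cell V F y)))" for x y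
    proof (intro conjI allI impI)
      assume xy: "E x y" "(x, y) \<in> V \<times> V" "(x, y) \<notin> P"
      then show "card (cell V F x) \<ge> \<kappa> * n" "card (cell V F y) \<ge> \<kappa> * n" "\<gamma> \<le> m (x, y)"
        by (auto simp: P_def S_def L_def not_less)
      show "m (x, y) \<le> 1"
        unfolding m_def pair_mean_def using finV by (intro cond_mean_bounds) (auto simp: e_def)
      fix X Y assume XY: "X \<subseteq> cell V F x" "Y \<subseteq> cell V F y"
      have "(x, y) \<notin> I" using xy by (auto simp: P_def)
      then have "\<bar>\<Sum>w\<in>X \<times> Y. e w - m w\<bar> \<le> \<epsilon> * card (cell V F x \<times> cell V F y)"
        using xy(2) XY unfolding I_def irregular_pairs_def m_def by (auto simp: not_less)
      \<comment> \<open>The density is constant on the product of the two cells, so it may be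
        evaluated at \<open>(x, y)\<close>.\<close>
      moreover have "(\<Sum>w\<in>X \<times> Y. e w - m w) = (\<Sum>w\<in>X \<times> Y. e w - m (x, y))"
      proof (rule sum.cong[OF refl])
        fix w assume "w \<in> X \<times> Y"
        then have "w \<in> cell V F x \<times> cell V F y" using XY by auto
        then have "pair_class F w = pair_class F (x, y)"
          using pair_class_fiber[of V F "(x, y)"] by auto
        then have "m w = m (x, y)"
          unfolding m_def pair_mean_def by (rule cond_mean_cong)
        then show "e w - m w = e w - m (x, y)" by simp
      qed
      ultimately show "\<bar>\<Sum>u\<in>X. \<Sum>v\<in>Y. of_bool (E u v) - m (x, y)\<bar> \<le>
          \<epsilon> * (card (cell V F x) * card (cell V F y))"
        by (simp add: sum.cartesian_product e_def card_cartesian_product case_prod_beta)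
    qed
    have cover: "(x, y) \<in> P \<or> (y, z) \<in> P \<or> (x, z) \<in> P"
      if V: "x \<in> V" "y \<in> V" "z \<in> V" and E: "E x y" "E y z" "E x z" for x y z
    proof (rule ccontr)
      assume "\<not> ?thesis"
      then have xy: "(x, y) \<notin> P" and yz: "(y, z) \<notin> P" and xz: "(x, z) \<notin> P" by auto
      let ?A = "cell V F x" and ?B = "cell V F y" and ?C = "cell V F z"
      have V2: "(x, y) \<in> V \<times> V" "(y, z) \<in> V \<times> V" "(x, z) \<in> V \<times> V" using V by auto
      note good_xy = good[OF E(1) V2(1) xy] and good_yz = good[OF E(2) V2(2) yz]
        and good_xz = good[OF E(3) V2(3) xz]
      have cells: "\<kappa> * n \<le> card ?A" "\<kappa> * n \<le> card ?B" "\<kappa> * n \<le> card ?C"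
        using good_xy good_yz by blast+
      have dense: "\<gamma> \<le> m (x, y)" "\<gamma> \<le> m (y, z)" "\<gamma> \<le> m (x, z)"
        using good_xy good_yz good_xz by blast+
      have le1: "m (x, y) \<le> 1" "m (y, z) \<le> 1"
        using good_xy good_yz by blast+
      let ?T = "{(x, y, z) \<in> V \<times> V \<times> V. E x y \<and> E y z \<and> E x z}"
      have "(m (x, y) * m (y, z) * m (x, z) - 3 * \<epsilon>) * (card ?A * card ?B * card ?C)
          \<le> (\<Sum>x\<in>?A. \<Sum>y\<in>?B. \<Sum>z\<in>?C. of_bool (E x y \<and> E y z \<and> E x z))"
      \<comment> \<open>Some of the three cells may coincide; the count is of ordered triples, so no
        disjointness enters.\<close>
      proof (rule triangle_counting)
        show "0 \<le> m (x, y)" "0 \<le> m (y, z)" using dense \<gamma>(1) by linarith+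
        show "\<bar>\<Sum>u\<in>X. \<Sum>v\<in>Y. of_bool (E u v) - m (x, y)\<bar> \<le> \<epsilon> * (card ?A * card ?B)"
          if "X \<subseteq> ?A" "Y \<subseteq> ?B" for X Y using good_xy that by blast
        show "\<bar>\<Sum>u\<in>X. \<Sum>v\<in>Y. of_bool (E u v) - m (y, z)\<bar> \<le> \<epsilon> * (card ?B * card ?C)"
          if "X \<subseteq> ?B" "Y \<subseteq> ?C" for X Y using good_yz that by blast
        show "\<bar>\<Sum>u\<in>X. \<Sum>v\<in>Y. of_bool (E u v) - m (x, z)\<bar> \<le> \<epsilon> * (card ?A * card ?C)"
          if "X \<subseteq> ?A" "Y \<subseteq> ?C" for X Y using good_xz that by blast
      qed (fact le1 finite_cell[OF finV])+
      also have "\<dots> = (\<Sum>w\<in>?A \<times> ?B \<times> ?C. of_bool (w \<in> ?T))"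
        unfolding sum.cartesian_product
      proof (rule sum.cong[OF refl])
        fix w assume "w \<in> ?A \<times> ?B \<times> ?C"
        then have "w \<in> V \<times> V \<times> V" by (auto simp: cell_def)
        then show "(case w of (x, y, z) \<Rightarrow> of_bool (E x y \<and> E y z \<and> E x z)) = (of_bool (w \<in> ?T) :: real)"
          by (cases w) simp
      qed
      also have "\<dots> = card ((?A \<times> ?B \<times> ?C) \<inter> ?T)"
        using finite_cell[OF finV] by simp
      also have "\<dots> \<le> card ?T"
        using finV by (intro of_nat_mono card_mono) (auto intro: finite_subset[of _ "V \<times> V \<times> V"])
      finally have "(m (x, y) * m (y, z) * m (x, z) - 3 * \<epsilon>) * (card ?A * card ?B * card ?C) \<le> card ?T" .
      moreover have "(\<gamma> ^ 3 / 2) * (\<kappa> ^ 3 * n ^ 3) \<le>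
          (m (x, y) * m (y, z) * m (x, z) - 3 * \<epsilon>) * (card ?A * card ?B * card ?C)"
      proof (rule mult_mono)
        have "\<gamma> * \<gamma> * \<gamma> \<le> m (x, y) * m (y, z) * m (x, z)"
          using dense \<gamma>(1) by (intro mult_mono) auto
        then show *: "\<gamma> ^ 3 / 2 \<le> m (x, y) * m (y, z) * m (x, z) - 3 * \<epsilon>"
          by (simp add: \<epsilon>_def power3_eq_cube)
        have "0 \<le> \<gamma> ^ 3 / 2" using \<gamma> by simp
        with * show "0 \<le> m (x, y) * m (y, z) * m (x, z) - 3 * \<epsilon>" by linarith
        have "(\<kappa> * n) * (\<kappa> * n) * (\<kappa> * n) \<le> real (card ?A) * real (card ?B) * real (card ?C)"
          using cells \<kappa> n0 by (intro mult_mono) auto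
        then show "\<kappa> ^ 3 * n ^ 3 \<le> real (card ?A * card ?B * card ?C)"
          by (simp add: power3_eq_cube algebra_simps)
        show "0 \<le> \<kappa> ^ 3 * n ^ 3" using \<kappa> n0 by simp
      qed
      ultimately show False using few by (simp add: n_def algebra_simps)
    qed
    show "\<exists>P \<subseteq> {(x, y) \<in> V \<times> V. E x y}. card P \<le> \<delta> * (card V)\<^sup>2 \<and>
      (\<forall>x\<in>V. \<forall>y\<in>V. \<forall>z\<in>V. E x y \<and> E y z \<and> E x z \<longrightarrow> (x, y) \<in> P \<or> (y, z) \<in> P \<or> (x, z) \<in> P)"
    proof (intro exI[of _ P] conjI)
      show "P \<subseteq> {(x, y) \<in> V \<times> V. E x y}" by (auto simp: P_def)
    qed (use cardP cover in \<open>auto simp: n_def\<close>)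
  qed
qed

section \<open>Triangles over a set of pairs\<close>

text \<open>Double counting of the pairs of a vertex \<open>w\<close> and an \<open>a\<close>-subset
  of its neighbours in \<open>X\<close>.\<close>

lemma sum_card_choose_le:
  assumes fin: "finite N" "finite X"
    and common: "\<And>S. S \<subseteq> X \<Longrightarrow> card S = a \<Longrightarrow> card {w\<in>N. \<forall>s\<in>S. E s w} \<le> b"
  shows "(\<Sum>w\<in>N. card {x\<in>X. E x w} choose a) \<le> b * (card X choose a)"
proof -
  let ?SS = "{S. S \<subseteq> X \<and> card S = a}"
  have finSS: "finite ?SS" using fin(2) by simp
  have "(\<Sum>w\<in>N. card {x\<in>X. E x w} choose a) = (\<Sum>w\<in>N. card {S\<in>?SS. \<forall>s\<in>S. E s w})"
  proof (rule sum.cong[OF refl])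
    fix w
    have "{S\<in>?SS. \<forall>s\<in>S. E s w} = {S. S \<subseteq> {x\<in>X. E x w} \<and> card S = a}" by blast
    then show "card {x\<in>X. E x w} choose a = card {S\<in>?SS. \<forall>s\<in>S. E s w}"
      using n_subsets[of "{x\<in>X. E x w}" a] fin(2) by simp
  qed
  also have "\<dots> = (\<Sum>w\<in>N. \<Sum>S\<in>{S\<in>?SS. \<forall>s\<in>S. E s w}. 1)" by simp
  also have "\<dots> = (\<Sum>S\<in>?SS. \<Sum>w\<in>{w\<in>N. \<forall>s\<in>S. E s w}. 1)"
    by (rule sum.swap_restrict[OF fin(1) finSS])
  also have "\<dots> = (\<Sum>S\<in>?SS. card {w\<in>N. \<forall>s\<in>S. E s w})" by simp
  also have "\<dots> \<le> (\<Sum>S\<in>?SS. b)" by (rule sum_mono) (use common in blast)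
  also have "\<dots> = b * (card X choose a)" using n_subsets[OF fin(2)] by simp
  finally show ?thesis .
qed

lemma choose_le_pow: "n choose a \<le> n ^ a"
  by (cases "a \<le> n") (auto simp: binomial_le_pow binomial_eq_0)

text \<open>Splitting the degrees at a threshold \<open>K\<close> takes the place of the usual convexity argument.\<close>

lemma sum_degrees_le:
  fixes K :: real
  assumes fin: "finite N" "finite X" and "1 \<le> a"
    and K: "0 < K" "\<And>k. K < real k \<Longrightarrow> a \<le> k"
    and common: "\<And>S. S \<subseteq> X \<Longrightarrow> card S = a \<Longrightarrow> card {w\<in>N. \<forall>s\<in>S. E s w} \<le> b"
  shows "(\<Sum>w\<in>N. card {x\<in>X. E x w}) \<le> card N * K + real a ^ a * b * real (card X) ^ a / K ^ (a - 1)"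
proof -
  let ?k = "\<lambda>w. card {x\<in>X. E x w}"
  \<comment> \<open>Degrees up to \<open>K\<close> are absorbed by the first term. For k > K one has
    k \<le> k^a / K^(a-1), and k^a \<le> a^a (k choose a) because the assumption on \<open>K\<close>
    gives a \<le> k.\<close>
  have pointwise: "real k \<le> K + real a ^ a * (k choose a) / K ^ (a - 1)" for k
  proof (cases "K < k")
    case True
    then have "a \<le> k" by (rule K(2))
    have "real k * K ^ (a - 1) \<le> real k * real k ^ (a - 1)"
      using True K(1) by (intro mult_left_mono power_mono) auto
    also have "\<dots> = real k ^ a" using \<open>1 \<le> a\<close> by (simp add: power_eq_if)
    also have "\<dots> \<le> real a ^ a * (k choose a)"
      using binomial_ge_n_over_k_pow_k[where 'a = real, OF \<open>a \<le> k\<close>] \<open>1 \<le> a\<close>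
      by (simp add: field_simps power_divide)
    finally have "real k \<le> real a ^ a * (k choose a) / K ^ (a - 1)"
      using K(1) by (simp add: pos_le_divide_eq)
    then show ?thesis using K(1) by simp
  next
    case False
    have "0 \<le> real a ^ a * (k choose a) / K ^ (a - 1)" using K(1) by simp
    with False show ?thesis by linarith
  qed
  have "real (\<Sum>w\<in>N. ?k w) \<le> (\<Sum>w\<in>N. K + real a ^ a * (?k w choose a) / K ^ (a - 1))"
    unfolding of_nat_sum by (rule sum_mono) (rule pointwise)
  also have "\<dots> = card N * K + real a ^ a * real (\<Sum>w\<in>N. ?k w choose a) / K ^ (a - 1)"
    by (simp add: sum.distrib sum_distrib_left sum_divide_distrib)
  also have "\<dots> \<le> card N * K + real a ^ a * real (b * card X ^ a) / K ^ (a - 1)"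
  proof -
    have "(\<Sum>w\<in>N. ?k w choose a) \<le> b * card X ^ a"
      using sum_card_choose_le[OF fin common] choose_le_pow[of "card X" a]
      by (meson mult_le_mono2 order.trans)
    then show ?thesis
      using K(1) by (intro add_left_mono divide_right_mono mult_left_mono of_nat_mono) auto
  qed
  finally show ?thesis by (simp add: mult.assoc)
qed

text \<open>\<open>sum_degrees_le\<close> is applied at every \<open>v\<close> to its
  \<open>P\<close>-neighbours and its \<open>E\<close>-neighbourhood. The power
  \<open>card (X v) ^ a\<close> is bounded linearly in \<open>card (X v)\<close>, so that summing
  over \<open>v\<close> produces \<open>card P\<close>.\<close>

lemma card_triangles_over_pairs_le:
  fixes K :: real
  assumes fin: "finite V" and "1 \<le> a"
    and K: "0 < K" "\<And>k. K < real k \<Longrightarrow> a \<le> k"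
    and common: "\<And>v S. v \<in> V \<Longrightarrow> S \<subseteq> V \<Longrightarrow> card S = a \<Longrightarrow> (\<forall>s\<in>S. E s v) \<Longrightarrow>
      card {w\<in>V. E v w \<and> (\<forall>s\<in>S. E s w)} \<le> b"
    and P: "P \<subseteq> {(u, v) \<in> V \<times> V. E u v}"
  shows "card {(u, v, w) \<in> V \<times> V \<times> V. (u, v) \<in> P \<and> E v w \<and> E u w}
    \<le> (card V)\<^sup>2 * K + real a ^ a * b * (card V / K) ^ (a - 1) * card P"
proof -
  define n where "n = real (card V)"
  define X where "X v = {u. (u, v) \<in> P}" for v
  define N where "N v = {w\<in>V. E v w}" for v
  have XV: "X v \<subseteq> V" for v using P by (auto simp: X_def)
  have finX: "finite (X v)" for v using finite_subset[OF XV fin] .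
  have finN: "finite (N v)" for v using fin by (simp add: N_def)
  let ?T = "{(u, v, w) \<in> V \<times> V \<times> V. (u, v) \<in> P \<and> E v w \<and> E u w}"
  let ?T' = "SIGMA v:V. SIGMA w:N v. {u\<in>X v. E u w}"
  \<comment> \<open>Grouping the triples by the middle vertex \<open>v\<close> turns the count into
    a sum of degrees.\<close>
  have "?T = (\<lambda>(v, w, u). (u, v, w)) ` ?T'"
    using P by (auto simp: X_def N_def image_iff split_beta)
  moreover have "finite ?T'" using fin finN finX by simp
  ultimately have "card ?T \<le> card ?T'" by (simp only: card_image_le)
  also have "\<dots> = (\<Sum>v\<in>V. \<Sum>w\<in>N v. card {u\<in>X v. E u w})"
    using fin finN finX by (simp add: card_SigmaI)
  finally have "real (card ?T) \<le> (\<Sum>v\<in>V. real (\<Sum>w\<in>N v. card {u\<in>X v. E u w}))"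
    by (simp flip: of_nat_sum)
  also have "\<dots> \<le> (\<Sum>v\<in>V. n * K + real a ^ a * b * (n / K) ^ (a - 1) * card (X v))"
  proof (rule sum_mono)
    fix v assume v: "v \<in> V"
    have "real (\<Sum>w\<in>N v. card {u\<in>X v. E u w})
        \<le> card (N v) * K + real a ^ a * b * real (card (X v)) ^ a / K ^ (a - 1)"
    proof (rule sum_degrees_le[OF finN finX \<open>1 \<le> a\<close> K])
      fix S assume S: "S \<subseteq> X v" "card S = a"
      then have "\<forall>s\<in>S. E s v" using P by (auto simp: X_def)
      then have "card {w\<in>V. E v w \<and> (\<forall>s\<in>S. E s w)} \<le> b"
        using common[of v S] v S XV by blast
      then show "card {w\<in>N v. \<forall>s\<in>S. E s w} \<le> b" by (simp add: N_def conj_assoc)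
    qed
    also have "\<dots> \<le> n * K + real a ^ a * b * (n ^ (a - 1) * card (X v)) / K ^ (a - 1)"
    proof (intro add_mono mult_right_mono divide_right_mono mult_left_mono)
      show "real (card (N v)) \<le> n"
        using fin by (auto simp: n_def N_def intro: card_mono)
      have "real (card (X v)) ^ a = real (card (X v)) ^ (a - 1) * card (X v)"
        using \<open>1 \<le> a\<close> by (simp add: power_eq_if)
      also have "\<dots> \<le> n ^ (a - 1) * card (X v)"
        using card_mono[OF fin XV] by (intro mult_right_mono power_mono) (auto simp: n_def)
      finally show "real (card (X v)) ^ a \<le> n ^ (a - 1) * card (X v)" .
    qed (use K(1) in auto)
    finally show "real (\<Sum>w\<in>N v. card {u\<in>X v. E u w})
        \<le> n * K + real a ^ a * b * (n / K) ^ (a - 1) * card (X v)"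
      by (simp add: power_divide)
  qed
  also have "\<dots> = n\<^sup>2 * K + real a ^ a * b * (n / K) ^ (a - 1) * (\<Sum>v\<in>V. card (X v))"
    by (simp add: sum.distrib sum_distrib_left n_def power2_eq_square)
  also have "(\<Sum>v\<in>V. card (X v)) = card P"
  proof -
    have "P = (\<lambda>(v, u). (u, v)) ` (SIGMA v:V. X v)"
      using P by (auto simp: X_def image_iff)
    moreover have "inj_on (\<lambda>(v, u). (u, v)) (SIGMA v:V. X v)"
      by (auto simp: inj_on_def)
    ultimately have "card P = card (SIGMA v:V. X v)" using card_image by fastforce
    then show ?thesis using fin finX by (simp add: card_SigmaI)
  qed
  finally show ?thesis by (simp add: n_def)
qed

section \<open>Copies of triangles and of complete tripartite graphs\<close>

lemma edges_subset_verts: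
  assumes "simple_graph G" "{x, y} \<in> edges G"
  shows "x \<in> verts G" "y \<in> verts G" "x \<noteq> y"
proof -
  have "{x, y} \<subseteq> verts G" "card {x, y} = 2" using assms by (auto simp: simple_graph_def)
  then show "x \<in> verts G" "y \<in> verts G" "x \<noteq> y" by auto
qed

text \<open>Every copy is the image under \<open>h\<close> of an ordered triangle; the repeated
  counting of each copy only costs a constant factor.\<close>

lemma card_triangle_copies_le:
  assumes G: "simple_graph G"
  shows "card (copies (complete_graph 3) G) \<le> card {(x, y, z) \<in> verts G \<times> verts G \<times> verts G.
    {x, y} \<in> edges G \<and> {y, z} \<in> edges G \<and> {x, z} \<in> edges G}"
proof -
  let ?T = "{(x, y, z) \<in> verts G \<times> verts G \<times> verts G.
    {x, y} \<in> edges G \<and> {y, z} \<in> edges G \<and> {x, z} \<in> edges G}"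
  define h where "h = (\<lambda>(x, y, z). ({x, y, z}, {{x, y}, {y, z}, {x, z :: 'a}}))"
  have finT: "finite ?T"
    by (rule finite_subset[of _ "verts G \<times> verts G \<times> verts G"]) (use G in \<open>auto simp: simple_graph_def\<close>)
  have vK: "{..<3} = {0, 1, 2 :: nat}" by auto
  have eK: "{e. e \<subseteq> {0, 1, 2 :: nat} \<and> card e = 2} = {{0, 1}, {1, 2}, {0, 2}}"
  proof
    show "{e. e \<subseteq> {0, 1, 2 :: nat} \<and> card e = 2} \<subseteq> {{0, 1}, {1, 2}, {0, 2}}"
      by (auto simp: card_2_iff doubleton_eq_iff)
  qed auto
  have "copies (complete_graph 3) G \<subseteq> h ` ?T"
  proof
    fix S assume "S \<in> copies (complete_graph 3) G"
    then obtain f where S: "subgraph S G" and "bij_betw f {0, 1, 2} (verts S)"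
      and eS: "edges S = (\<lambda>e. f ` e) ` {{0, 1}, {1, 2}, {0, 2 :: nat}}"
      unfolding copies_def graph_iso_def complete_graph_def vK eK by auto
    then have vS: "verts S = {f 0, f 1, f 2}" by (auto simp: bij_betw_def)
    have "(f 0, f 1, f 2) \<in> ?T" using S vS eS by (auto simp: subgraph_def)
    moreover have "S = h (f 0, f 1, f 2)" using vS eS by (simp add: h_def prod_eq_iff)
    ultimately show "S \<in> h ` ?T" by blast
  qed
  then have "card (copies (complete_graph 3) G) \<le> card (h ` ?T)" using finT by (intro card_mono) auto
  then show ?thesis using card_image_le[OF finT, of h] by linarith
qed

text \<open>Otherwise \<open>v\<close>, \<open>S\<close> and any \<open>b\<close> of these common
  neighbours form the three parts of a forbidden copy.\<close>

lemma tripartite_free_card_common_neighbours: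
  fixes G :: "'a ugraph"
  assumes G: "simple_graph G" and free: "free_of (complete_tripartite 1 a b) G"
    and v: "v \<in> verts G" and S: "S \<subseteq> verts G" "card S = a" "\<forall>s\<in>S. {s, v} \<in> edges G"
  shows "card {w\<in>verts G. {v, w} \<in> edges G \<and> (\<forall>s\<in>S. {s, w} \<in> edges G)} < b"
proof (rule ccontr)
  let ?W = "{w\<in>verts G. {v, w} \<in> edges G \<and> (\<forall>s\<in>S. {s, w} \<in> edges G)}"
  assume "\<not> card ?W < b"
  then obtain T where T: "T \<subseteq> ?W" "card T = b" by (meson not_less obtain_subset_with_card_n)
  have finG: "finite (verts G)" using G by (simp add: simple_graph_def)
  have fin: "finite S" "finite T" using finite_subset[OF S(1) finG] finite_subset[OF T(1)] finG by auto
  obtain g where g: "bij_betw g {..<a} S"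
    using ex_bij_betw_nat_finite[OF fin(1)] S(2) by (auto simp: atLeast0LessThan)
  obtain h where h: "bij_betw h {..<b} T"
    using ex_bij_betw_nat_finite[OF fin(2)] T(2) by (auto simp: atLeast0LessThan)
  define f where "f p = (if fst p = 0 then v else if fst p = (1::nat) then g (snd p) else h (snd p))" for p
  let ?H = "complete_tripartite 1 a b"
  have gS: "g i \<in> S" if "i < a" for i using g that by (auto simp: bij_betw_def)
  have hT: "h i \<in> T" if "i < b" for i using h that by (auto simp: bij_betw_def)
  have Tadj: "{v, t} \<in> edges G" "\<And>s. s \<in> S \<Longrightarrow> {s, t} \<in> edges G" if "t \<in> T" for t
    using T(1) that by auto
  have TV: "T \<subseteq> verts G" using T(1) by auto
  have Sadj: "{v, s} \<in> edges G" if "s \<in> S" for s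
    using S(3) that by (metis insert_commute)
  have finH: "finite (verts ?H)" using simple_graph_complete_tripartite by (auto simp: simple_graph_def)
  have vH: "verts ?H = tripartite_verts 1 a b" by (simp add: complete_tripartite_def)
  have adj_less: "{f p, f q} \<in> edges G"
    if "p \<in> verts ?H" "q \<in> verts ?H" "fst p < fst q" for p q
    using that Sadj[OF gS] Tadj(1)[OF hT] Tadj(2)[OF hT gS] unfolding vH
    by (auto simp: tripartite_verts_def f_def)
  have adj: "{f p, f q} \<in> edges G"
    if "p \<in> verts ?H" "q \<in> verts ?H" "fst p \<noteq> fst q" for p q
    using adj_less[of p q] adj_less[of q p] that by (auto simp: insert_commute nat_neq_iff)
  have inj: "inj_on f (verts ?H)"
  proof (rule inj_onI)
    fix p q assume pq: "p \<in> verts ?H" "q \<in> verts ?H" "f p = f q"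
    \<comment> \<open>Vertices in different parts have adjacent images, and adjacent vertices are
      distinct; within a part \<open>g\<close> and \<open>h\<close> are injective.\<close>
    have "fst p = fst q" using adj[OF pq(1,2)] pq(3) edges_subset_verts(3)[OF G] by blast
    then show "p = q"
      using pq g h unfolding vH
      by (auto simp: tripartite_verts_def f_def bij_betw_def inj_on_def)
  qed
  \<comment> \<open>The copy carries only the image edges, since \<open>G\<close> may have further
    edges inside the parts.\<close>
  define C where "C = (f ` verts ?H, (\<lambda>e. f ` e) ` edges ?H)"
  have "f ` e \<in> edges G \<and> f ` e \<subseteq> f ` verts ?H" if "e \<in> edges ?H" for e
    using that adj by (auto simp: complete_tripartite_def)
  moreover have "f p \<in> verts G" if "p \<in> verts ?H" for p
    using that gS hT S(1) TV v unfolding vH by (auto simp: tripartite_verts_def f_def)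
  ultimately have "subgraph C G"
    using G finH by (auto simp: subgraph_def simple_graph_def C_def)
  moreover have "graph_iso ?H C"
    unfolding graph_iso_def C_def using inj by (intro exI[of _ f]) (simp add: bij_betw_def)
  ultimately show False using free unfolding free_of_def copies_def by blast
qed

section \<open>Asymptotics\<close>

text \<open>This choice of \<open>K\<close> balances the two terms of
  \<open>card_triangles_over_pairs_le\<close> when \<open>P\<close> has order n^2: both get the
  exponent 3 - 1/a.\<close>

lemma threshold_powr_identities:
  fixes n e :: real
  assumes "0 < n" "0 < e" "1 \<le> a"
  defines "K \<equiv> e * n powr (1 - 1 / real a)"
  shows "n\<^sup>2 * K = e * n powr (3 - 1 / real a)"
    and "(n / K) ^ (a - 1) * n\<^sup>2 = n powr (3 - 1 / real a) / e ^ (a - 1)"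
proof -
  have sq: "n\<^sup>2 = n powr 2" using assms(1) by (simp add: powr_numeral)
  have "n\<^sup>2 * K = e * (n powr 2 * n powr (1 - 1 / real a))" by (simp add: K_def sq)
  also have "n powr 2 * n powr (1 - 1 / real a) = n powr (3 - 1 / real a)"
    by (simp flip: powr_add)
  finally show "n\<^sup>2 * K = e * n powr (3 - 1 / real a)" .
  have "n / n powr (1 - 1 / real a) = n powr (1 / real a)"
    using assms(1) powr_diff[of n 1 "1 - 1 / real a"] by simp
  then have nK: "n / K = n powr (1 / real a) / e"
    using assms(2) by (simp add: K_def field_simps)
  have "(n powr (1 / real a)) ^ (a - 1) = n powr (1 / real a * real (a - 1))"
    using assms(1) by (simp add: powr_powr flip: powr_realpow)
  also have "1 / real a * real (a - 1) = 1 - 1 / real a"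
    using assms(3) by (simp add: field_simps of_nat_diff)
  finally have "(n / K) ^ (a - 1) * n\<^sup>2 = n powr (1 - 1 / real a) * n powr 2 / e ^ (a - 1)"
    by (simp add: nK power_divide sq)
  also have "n powr (1 - 1 / real a) * n powr 2 = n powr (3 - 1 / real a)"
    by (simp flip: powr_add)
  finally show "(n / K) ^ (a - 1) * n\<^sup>2 = n powr (3 - 1 / real a) / e ^ (a - 1)" .
qed

text \<open>For a > 1 the threshold tends to infinity. For a = 1 it stays bounded, but it is
  nonnegative, so a larger \<open>k\<close> is at least 1.\<close>

lemma eventually_threshold:
  fixes e :: real
  assumes "0 < e" "1 \<le> a"
  shows "\<forall>\<^sub>F n :: nat in sequentially. \<forall>k. e * real n powr (1 - 1 / real a) < real k \<longrightarrow> a \<le> k"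
proof (cases "a = 1")
  case True
  have "a \<le> k" if "e * real n powr (1 - 1 / real a) < real k" for n k :: nat
  proof -
    have "0 \<le> e * real n powr (1 - 1 / real a)" using assms(1) by simp
    then have "0 < k" using that by (cases k) auto
    then show ?thesis using True by simp
  qed
  then show ?thesis by simp
next
  case False
  then have "0 < 1 - 1 / real a" using assms(2) by simp
  then have "filterlim (\<lambda>n :: nat. e * real n powr (1 - 1 / real a)) at_top sequentially"
    using assms(1) by real_asymp
  then have "\<forall>\<^sub>F n :: nat in sequentially. real a \<le> e * real n powr (1 - 1 / real a)"
    by (simp add: filterlim_at_top)
  then show ?thesis by eventually_elim auto
qed

lemma eventually_few_triangles:
  fixes c :: real
  assumes "1 \<le> a" "0 < c"
  shows "\<forall>\<^sub>F n in sequentially. \<forall>(V :: 'a set) E. finite V \<longrightarrow> card V = n \<longrightarrow>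
    (\<forall>x y. E x y \<longrightarrow> E y x) \<longrightarrow>
    (\<forall>v\<in>V. \<forall>S\<subseteq>V. card S = a \<longrightarrow> (\<forall>s\<in>S. E s v) \<longrightarrow> card {w\<in>V. E v w \<and> (\<forall>s\<in>S. E s w)} \<le> b) \<longrightarrow>
    card {(x, y, z) \<in> V \<times> V \<times> V. E x y \<and> E y z \<and> E x z} \<le> c * real n powr (3 - 1 / real a)"
proof -
  \<comment> \<open>A triangle can be covered in three positions, and each position costs two terms
    of size \<open>e\<close>.\<close>
  define e where "e = c / 6"
  define C where "C = real a ^ a * real b"
  \<comment> \<open>Chosen so that C \<delta> / e^(a-1) \<le> e; the summand 1 keeps the denominator
    positive even if C = 0.\<close>
  define \<delta> where "\<delta> = e * e ^ (a - 1) / (C + 1)"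
  have e: "0 < e" using assms by (simp add: e_def)
  have C: "0 \<le> C" by (simp add: C_def)
  have \<delta>: "0 < \<delta>" using assms e C by (simp add: \<delta>_def)
  obtain \<eta> :: real where \<eta>: "0 < \<eta>" and removal: "\<And>(V :: 'a set) E. finite V \<Longrightarrow>
    card {(x, y, z) \<in> V \<times> V \<times> V. E x y \<and> E y z \<and> E x z} < \<eta> * card V ^ 3 \<Longrightarrow>
    \<exists>P \<subseteq> {(x, y) \<in> V \<times> V. E x y}. card P \<le> \<delta> * (card V)\<^sup>2 \<and>
      (\<forall>x\<in>V. \<forall>y\<in>V. \<forall>z\<in>V. E x y \<and> E y z \<and> E x z \<longrightarrow> (x, y) \<in> P \<or> (y, z) \<in> P \<or> (x, z) \<in> P)"
    using triangle_removal[where 'a = 'a, OF \<delta>] by blast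
  have "0 < 1 / real a" "0 < 1 + C" using assms C by auto
  \<comment> \<open>The exponent 3 - 1/a is below 3, so the crude bound eventually meets the
    hypothesis of the removal lemma.\<close>
  then have "\<forall>\<^sub>F n in sequentially. (1 + C) * real n powr (3 - 1 / real a) < \<eta> * real n ^ 3"
    using \<eta> by real_asymp
  then show ?thesis
    using eventually_threshold[OF e assms(1)] eventually_threshold[OF zero_less_one assms(1)]
      eventually_gt_at_top[of 0]
  proof eventually_elim
    case (elim n)
    show ?case
    proof (intro allI impI)
      fix V :: "'a set" and E
      assume fin: "finite V" and cardV: "card V = n" and sym: "\<forall>x y. E x y \<longrightarrow> E y x"
        and common: "\<forall>v\<in>V. \<forall>S\<subseteq>V. card S = a \<longrightarrow> (\<forall>s\<in>S. E s v) \<longrightarrow>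
          card {w\<in>V. E v w \<and> (\<forall>s\<in>S. E s w)} \<le> b"
      define N where "N = real n powr (3 - 1 / real a)"
      define T where "T = {(x, y, z) \<in> V \<times> V \<times> V. E x y \<and> E y z \<and> E x z}"
      define Q where "Q P = {(x, y, z) \<in> V \<times> V \<times> V. (x, y) \<in> P \<and> E y z \<and> E x z}" for P
      have n0: "0 < real n" using elim(4) by simp
      have Q_le: "card (Q P) \<le> (t + C * (card P / (real n)\<^sup>2) / t ^ (a - 1)) * N"
        if t: "0 < t" "\<forall>k. t * real n powr (1 - 1 / real a) < real k \<longrightarrow> a \<le> k"
          and P: "P \<subseteq> {(x, y) \<in> V \<times> V. E x y}" for t P
      proof -
        define K where "K = t * real n powr (1 - 1 / real a)"
        have K: "(real n)\<^sup>2 * K = t * N" "(real n / K) ^ (a - 1) * (real n)\<^sup>2 = N / t ^ (a - 1)"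
          using threshold_powr_identities[OF n0 t(1) assms(1)] by (simp_all add: K_def N_def)
        have "card (Q P) \<le> (card V)\<^sup>2 * K + real a ^ a * b * (card V / K) ^ (a - 1) * card P"
          unfolding Q_def
        proof (rule card_triangles_over_pairs_le[OF fin assms(1) _ _ _ P])
          show "0 < K" using t(1) n0 by (simp add: K_def)
          show "a \<le> k" if "K < real k" for k using t(2) that by (simp add: K_def)
        qed (use common in blast)
        also have "\<dots> = t * N + C * ((real n / K) ^ (a - 1) * (real n)\<^sup>2) * (card P / (real n)\<^sup>2)"
          using n0 K(1) by (simp add: cardV C_def)
        also have "\<dots> = (t + C * (card P / (real n)\<^sup>2) / t ^ (a - 1)) * N"
          unfolding K(2) by (simp add: algebra_simps)
        finally show ?thesis .
      qed
      define D where "D = {(x, y) \<in> V \<times> V. E x y}"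
      have "card D \<le> card (V \<times> V)" using fin by (intro card_mono) (auto simp: D_def)
      then have "card D \<le> n ^ 2" by (simp add: cardV card_cartesian_product power2_eq_square)
      from of_nat_mono[where 'a = real, OF this] have "card D / (real n)\<^sup>2 \<le> 1"
        using n0 by simp
      then have D: "C * (card D / (real n)\<^sup>2) \<le> C * 1" using C by (intro mult_left_mono)
      \<comment> \<open>First use of \<open>Q_le\<close>, with all edges and t = 1; it only serves
        to make triangle removal applicable.\<close>
      have "T = Q D" by (auto simp: T_def Q_def D_def)
      then have "card T \<le> (1 + C * (card D / (real n)\<^sup>2)) * N"
        using Q_le[of 1 D] elim(3) by (simp add: D_def)
      also have "\<dots> \<le> (1 + C) * N" using D by (intro mult_right_mono) (auto simp: N_def)
      also have "\<dots> < \<eta> * real n ^ 3" using elim(1) by (simp add: N_def)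
      finally have "card T < \<eta> * card V ^ 3" by (simp add: cardV)
      then obtain P where P: "P \<subseteq> {(x, y) \<in> V \<times> V. E x y}" "card P \<le> \<delta> * (card V)\<^sup>2"
        and cover: "\<And>x y z. x \<in> V \<Longrightarrow> y \<in> V \<Longrightarrow> z \<in> V \<Longrightarrow> E x y \<Longrightarrow> E y z \<Longrightarrow> E x z \<Longrightarrow>
          (x, y) \<in> P \<or> (y, z) \<in> P \<or> (x, z) \<in> P"
        using removal[OF fin, of E] unfolding T_def by blast
      have finQ: "finite (Q P)"
        by (rule finite_subset[of _ "V \<times> V \<times> V"]) (use fin in \<open>auto simp: Q_def\<close>)
      \<comment> \<open>By symmetry of \<open>E\<close>, a triangle can be reordered so that its
        covered edge comes first; \<open>?f\<close> and \<open>?g\<close> undo the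
        reordering.\<close>
      let ?f = "\<lambda>(y, z, x). (x, y, z)" and ?g = "\<lambda>(x, z, y). (x, y, z)"
      have "T \<subseteq> Q P \<union> ?f ` Q P \<union> ?g ` Q P"
      proof
        fix w assume "w \<in> T"
        then obtain x y z where w: "w = (x, y, z)" and V: "x \<in> V" "y \<in> V" "z \<in> V"
          and E: "E x y" "E y z" "E x z" by (auto simp: T_def)
        have "(x, y, z) \<in> Q P \<or> (y, z, x) \<in> Q P \<or> (x, z, y) \<in> Q P"
          using cover[OF V E] V E sym by (auto simp: Q_def)
        then show "w \<in> Q P \<union> ?f ` Q P \<union> ?g ` Q P" unfolding w by force
      qed
      then have "card T \<le> card (Q P \<union> ?f ` Q P \<union> ?g ` Q P)"
        using finQ by (intro card_mono) auto
      also have "\<dots> \<le> card (Q P) + card (?f ` Q P) + card (?g ` Q P)"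
        by (intro order.trans[OF card_Un_le] add_mono order.refl)
      also have "\<dots> \<le> 3 * card (Q P)"
        using card_image_le[OF finQ, of ?f] card_image_le[OF finQ, of ?g] by linarith
      finally have "real (card T) \<le> 3 * real (card (Q P))" by simp
      \<comment> \<open>Second use of \<open>Q_le\<close>, now with the sparse cover
        \<open>P\<close> and the small parameter \<open>e\<close>.\<close>
      also have "\<dots> \<le> 3 * ((e + C * (card P / (real n)\<^sup>2) / e ^ (a - 1)) * N)"
        using Q_le[OF e elim(2) P(1)] by simp
      also have "\<dots> \<le> 3 * ((e + e) * N)"
      proof -
        have "card P / (real n)\<^sup>2 \<le> \<delta>" using P(2) n0 by (simp add: cardV pos_divide_le_eq)
        then have "C * (card P / (real n)\<^sup>2) \<le> C * \<delta>" using C by (rule mult_left_mono)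
        also have "\<dots> \<le> (C + 1) * \<delta>" using \<delta> by (intro mult_right_mono) auto
        also have "\<dots> = e * e ^ (a - 1)" using C by (simp add: \<delta>_def)
        finally have "C * (card P / (real n)\<^sup>2) / e ^ (a - 1) \<le> e"
          using e by (subst pos_divide_le_eq) auto
        then show ?thesis by (intro mult_left_mono mult_right_mono add_left_mono) (auto simp: N_def)
      qed
      also have "\<dots> = c * N" by (simp add: e_def)
      finally show "card {(x, y, z) \<in> V \<times> V \<times> V. E x y \<and> E y z \<and> E x z} \<le> c * real n powr (3 - 1 / real a)"
        by (simp add: T_def N_def)
    qed
  qed
qed

theorem theorem1p1:
  fixes a b :: nat
  assumes "1 \<le> a" and "a \<le> b"
  shows "(\<lambda>n::nat. real (generalized_turan n (complete_graph 3) (complete_tripartite 1 a b)))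
           \<in> o(\<lambda>n. real n powr (3 - 1 / real a))"
proof (rule landau_o.smallI)
  fix c :: real assume "0 < c"
  let ?H = "complete_tripartite 1 a b" and ?K3 = "complete_graph 3"
  \<comment> \<open>An edge of \<open>?H\<close> makes the set of counts nonempty, so its maximum is
    attained by some graph.\<close>
  have "{(0, 0), (1, 0)} \<in> edges ?H"
    using assms(1) by (force simp: complete_tripartite_def tripartite_verts_def)
  then have edges_H: "edges ?H \<noteq> {}" by blast
  show "\<forall>\<^sub>F n in sequentially. norm (real (generalized_turan n ?K3 ?H))
    \<le> c * norm (real n powr (3 - 1 / real a))"
    using eventually_few_triangles[where 'a = nat and b = b, OF assms(1) \<open>0 < c\<close>]
  proof eventually_elim
    case (elim n)
    have "generalized_turan n ?K3 ?H \<in> turan_counts n ?K3 ?H"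
      unfolding generalized_turan_def
      by (rule Max_in[OF finite_turan_counts turan_counts_nonempty[OF edges_H]])
    then obtain G :: "nat ugraph" where G: "simple_graph G" "card (verts G) = n" "free_of ?H G"
      and eq: "generalized_turan n ?K3 ?H = card (copies ?K3 G)"
      by (auto simp: turan_counts_def)
    have "real (card (copies ?K3 G)) \<le> card {(x, y, z) \<in> verts G \<times> verts G \<times> verts G.
        {x, y} \<in> edges G \<and> {y, z} \<in> edges G \<and> {x, z} \<in> edges G}"
      using card_triangle_copies_le[OF G(1)] by (rule of_nat_mono)
    also have "\<dots> \<le> c * real n powr (3 - 1 / real a)"
    proof (rule elim[rule_format])
      show "finite (verts G)" using G(1) by (simp add: simple_graph_def)
      show "card {w\<in>verts G. {v, w} \<in> edges G \<and> (\<forall>s\<in>S. {s, w} \<in> edges G)} \<le> b"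
        if "v \<in> verts G" "S \<subseteq> verts G" "card S = a" "\<And>s. s \<in> S \<Longrightarrow> {s, v} \<in> edges G" for v S
        using tripartite_free_card_common_neighbours[OF G(1,3) that(1-3)] that(4) by (simp add: less_imp_le)
    qed (use G(2) in \<open>auto simp: insert_commute\<close>)
    finally show ?case unfolding eq by simp
  qed
qed

end
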